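(* Let $\{x^k\}_{k\ge0}$ be generated by the Randomized Block Coordinate Descent method (RBCD) of the context with parameter $\alpha\in[0,1]$. Suppose $f:\mathbb{R}^d\to\mathbb{R}$ is continuously differentiable, convex, coercive, and Hölder smooth and block Hölder smooth with exponent $\gamma\in(0,1]$, with minimum value $f^*$. With $\nu=\frac{1+\gamma}{\gamma}$ and $R=R_{(1+\alpha-\nu)(1-\nu),\frac{\nu}{\nu-1}}(x^0)$, $$\mathbb{E}[f(x^k)]-f^*\le\frac{\left(\nu S_\alpha(f)R^\nu\right)^{\frac1{\nu-1}}(\nu-1)}{\left[2\nu^{\nu-1}+(\nu-1)^\nu k\right]^{\frac1{\nu-1}}}=\mathcal{O}\left(k^{-\frac1{\nu-1}}\right).$$
   Context: $P_1,\dots,P_m\in\mathbb{R}^{d\times d}$ are orthogonal projection matrices onto mutually orthogonal subspaces that sum to $\mathbb{R}^d$; $\nabla_if(x)=P_i\nabla f(x)$; $\|\cdot\|$ is the Euclidean norm. Hölder smooth: there is $L>0$ with $\|\nabla f(y)-\nabla f(x)\|\le L\|y-x\|^\gamma$ for all $x,y$. Block Hölder smooth: for each $i$ there is $L_i>0$ with $\|\nabla f(x+P_iu)-\nabla f(x)\|\le L_i\|P_iu\|^\gamma$ for all $x,u\in\mathbb{R}^d$. Coercive means bounded sublevel sets. $S_\alpha(f)=\sum_{i=1}^mL_i^\alpha$. For $a\in\mathbb{R}$, $q\ge1$: $\|x\|_{a,q}=\left(\sum_{i=1}^mL_i^a\|P_ix\|^q\right)^{1/q}$, and $R_{a,q}(x)=\max\{\|y-x^*\|_{a,q}:f(x^*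 )=f^*,\ f(y)\le f(x)\}<\infty$. RBCD: given $x^0\in\mathbb{R}^d$ and $\alpha\in[0,1]$, for $k=0,1,2,\dots$ choose $i_k\in\{1,\dots,m\}$ at random (independently of the past) with probabilities $p_i=L_i^\alpha/\sum_jL_j^\alpha$, and set $x^{k+1}=x^k-\frac{\|\nabla_{i_k}f(x^k)\|^{\nu-2}}{L_{i_k}^{\nu-1}}\nabla_{i_k}f(x^k)$.
   Formalization: The first subscript of R is taken as (1+α−ν)/(1−ν) instead of the printed product (1+α−ν)(1−ν); the two agree for γ=1, and for γ<1 the printed bound fails, e.g. for f(x)=c(2/3)|x|^{3/2} on ℝ with small c, x⁰=1, α=0, k=0. *)

theory Defs
  imports "HOL-Probability.Probability" "HOL-Library.Landau_Symbols"
begin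

definition gradient :: "('a::euclidean_space \<Rightarrow> real) \<Rightarrow> 'a \<Rightarrow> 'a" where
  "gradient f x = (THE D. GDERIV f x :> D)"

definition continuously_differentiable :: "('a::euclidean_space \<Rightarrow> real) \<Rightarrow> bool" where
  "continuously_differentiable f \<longleftrightarrow>
     (\<forall>x. f differentiable (at x)) \<and> continuous_on UNIV (gradient f)"

definition coercive :: "('a::euclidean_space \<Rightarrow> real) \<Rightarrow> bool" where
  "coercive f \<longleftrightarrow> (\<forall>c. bounded {x. f x \<le> c})"

text \<open>Without hypotheses on \<open>f\<close> the minimum need not exist; it does when \<open>f\<close> is continuous and coercive.\<close>

definition min_value :: "('a \<Rightarrow> real) \<Rightarrow> real" where
  "min_value f = (LEAST v. v \<in> range f)"

definition holder_smooth :: "real \<Rightarrow> ('a::euclidean_space \<Rightarrow> real) \<Rightarrow> bool" where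
  "holder_smooth \<gamma> f \<longleftrightarrow>
     (\<exists>L>0. \<forall>x y. norm (gradient f y - gradient f x) \<le> L * norm (y - x) powr \<gamma>)"

definition orthogonal_projection :: "real ^ 'd ^ 'd \<Rightarrow> bool" where
  "orthogonal_projection A \<longleftrightarrow> A ** A = A \<and> transpose A = A"

definition block_decomposition :: "('m::finite \<Rightarrow> real ^ 'd ^ 'd) \<Rightarrow> bool" where
  "block_decomposition P \<longleftrightarrow>
     (\<forall>i. orthogonal_projection (P i)) \<and>
     (\<forall>i j. i \<noteq> j \<longrightarrow> (\<forall>x y. orthogonal (P i *v x) (P j *v y))) \<and>
     span (\<Union>i. range (\<lambda>x. P i *v x)) = UNIV"

definition block_gradient ::
    "('m::finite \<Rightarrow> real ^ 'd ^ 'd) \<Rightarrow> (real ^ 'd \<Rightarrow> real) \<Rightarrow> 'm \<Rightarrow> real ^ 'd \<Rightarrow> real ^ 'd" where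
  "block_gradient P f i x = P i *v gradient f x"

text \<open>The block constants \<open>L\<close> are an explicit argument because the method and its rate depend on them.
  The bound is on the full gradient, not only on its \<open>i\<close>-th block.\<close>

definition block_holder_smooth ::
    "('m::finite \<Rightarrow> real ^ 'd ^ 'd) \<Rightarrow> ('m \<Rightarrow> real) \<Rightarrow> real \<Rightarrow> (real ^ 'd \<Rightarrow> real) \<Rightarrow> bool" where
  "block_holder_smooth P L \<gamma> f \<longleftrightarrow>
     (\<forall>i. L i > 0 \<and>
        (\<forall>x u. norm (gradient f (x + P i *v u) - gradient f x) \<le> L i * norm (P i *v u) powr \<gamma>))"

definition S_sum :: "('m::finite \<Rightarrow> real) \<Rightarrow> real \<Rightarrow> real" where
  "S_sum L \<alpha> = (\<Sum>i\<in>UNIV. L i powr \<alpha>)"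

definition block_norm ::
    "('m::finite \<Rightarrow> real ^ 'd ^ 'd) \<Rightarrow> ('m \<Rightarrow> real) \<Rightarrow> real \<Rightarrow> real \<Rightarrow> real ^ 'd \<Rightarrow> real" where
  "block_norm P L a q x = (\<Sum>i\<in>UNIV. L i powr a * norm (P i *v x) powr q) powr (1 / q)"

text \<open>The bound on the expected gap is stated for \<open>a = (1 + \<alpha> - \<nu>) / (1 - \<nu>)\<close>, \<open>q = \<nu> / (\<nu> - 1)\<close>: the
  norm dual to the one with parameters \<open>1 + \<alpha> - \<nu>\<close> and \<open>\<nu>\<close>. The paper prints the product
  \<open>(1 + \<alpha> - \<nu>) * (1 - \<nu>)\<close> for \<open>a\<close>. It is the same number for \<open>\<nu> = 2\<close>, but for \<open>\<nu> > 2\<close> the bound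
  would be false: replacing \<open>f\<close> by \<open>c * f\<close> and \<open>L\<close> by \<open>c * L\<close> leaves the iterates unchanged and scales
  its left side by \<open>c\<close>, its right side by a power of \<open>c\<close> greater than 1; let \<open>c\<close> tend to 0.\<close>

definition level_radius ::
    "('m::finite \<Rightarrow> real ^ 'd ^ 'd) \<Rightarrow> ('m \<Rightarrow> real) \<Rightarrow> (real ^ 'd \<Rightarrow> real) \<Rightarrow>
     real \<Rightarrow> real \<Rightarrow> real ^ 'd \<Rightarrow> real" where
  "level_radius P L f a q x =
     (GREATEST r. r \<in> {block_norm P L a q (y - xs) |y xs. f xs = min_value f \<and> f y \<le> f x})"

text \<open>The sampled blocks \<open>I k\<close> are jointly independent, which says that each \<open>I k\<close> is independent of
  \<open>(I 0, \<dots>, I (k - 1))\<close>; hence it is independent of \<open>X 0, \<dots>, X k\<close> too. When the selected block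
  gradient vanishes the iterate does not move, whatever value \<open>0 powr (\<nu> - 2)\<close> has.\<close>

definition RBCD ::
    "'w measure \<Rightarrow> ('m::finite \<Rightarrow> real ^ 'd ^ 'd) \<Rightarrow> ('m \<Rightarrow> real) \<Rightarrow> (real ^ 'd \<Rightarrow> real) \<Rightarrow>
     real \<Rightarrow> real \<Rightarrow> real ^ 'd \<Rightarrow> (nat \<Rightarrow> 'w \<Rightarrow> 'm) \<Rightarrow> (nat \<Rightarrow> 'w \<Rightarrow> real ^ 'd) \<Rightarrow> bool" where
  "RBCD M P L f \<nu> \<alpha> x0 I X \<longleftrightarrow>
     prob_space M \<and>
     prob_space.indep_vars M (\<lambda>_. count_space UNIV) I UNIV \<and>
     (\<forall>k i. measure M {w \<in> space M. I k w = i} = L i powr \<alpha> / (\<Sum>j\<in>UNIV. L j powr \<alpha>)) \<and>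
     (\<forall>w\<in>space M. X 0 w = x0) \<and>
     (\<forall>k. \<forall>w\<in>space M.
        X (Suc k) w =
          X k w -
          (norm (block_gradient P f (I k w) (X k w)) powr (\<nu> - 2) / L (I k w) powr (\<nu> - 1)) *\<^sub>R
            block_gradient P f (I k w) (X k w))"

end

theory Submission
  imports Defs
begin

text \<open>By the descent lemma a step along block \<open>i\<close> lowers \<open>f\<close> by at least
  \<open>norm (P i *v gradient f x) powr \<nu> / (\<nu> * L i powr (\<nu> - 1))\<close>, hence on average by \<open>1 / (\<nu> * S)\<close> times
  the \<open>\<nu>\<close>-th power of the \<open>(1 + \<alpha> - \<nu>, \<nu>)\<close>-norm of the gradient, where \<open>S = S_sum L \<alpha>\<close>. By convexity
  and Hoelder's inequality that norm is at least \<open>(f x - min_value f) / R\<close>. With Jensen's inequality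
  the expected gap \<open>\<phi> k\<close> obeys \<open>\<phi> (k + 1) \<le> \<phi> k - \<phi> k powr \<nu> / C\<close> for \<open>C = \<nu> * S * R powr \<nu>\<close>, so that
  \<open>\<phi> k powr (1 - \<nu>)\<close> grows by at least \<open>(\<nu> - 1) / C\<close> in each step. The additive constant of the rate
  comes from bounding the initial gap by \<open>S powr \<gamma> * R powr (1 + \<gamma>) / (1 + \<gamma>)\<close>.\<close>

section \<open>Gradients, tangents of convex functions and the descent lemma\<close>

lemma gderiv_gradient:
  fixes f :: "'a::euclidean_space \<Rightarrow> real"
  assumes "f differentiable (at x)"
  shows "GDERIV f x :> gradient f x"
proof -
  obtain f' where f': "(f has_derivative f') (at x)"
    using assms differentiable_def by blast
  \<comment> \<open>The Riesz vector of \<open>f'\<close>. As \<open>gradient\<close> is a definite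
    description, both existence and uniqueness have to be shown.\<close>
  define D where "D = (\<Sum>b\<in>Basis. f' b *\<^sub>R b)"
  have lin: "linear f'"
    using f' has_derivative_linear by blast
  have "f' h = h \<bullet> D" for h
  proof -
    have "f' h = f' (\<Sum>b\<in>Basis. (h \<bullet> b) *\<^sub>R b)"
      by (simp add: euclidean_representation)
    also have "\<dots> = h \<bullet> D"
      by (simp add: D_def linear_sum[OF lin] linear_scale[OF lin] inner_sum_right mult.commute)
    finally show ?thesis .
  qed
  then have D: "GDERIV f x :> D"
    using f' by (simp add: gderiv_def has_derivative_eq_rhs[OF f'] fun_eq_iff)
  have "E = D" if "GDERIV f x :> E" for E
  proof -
    have "(\<lambda>h. h \<bullet> E) = (\<lambda>h. h \<bullet> D)"
      using that D unfolding gderiv_def by (rule has_derivative_unique)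
    then show ?thesis
      by (metis inner_commute vector_eq_rdot)
  qed
  with D show ?thesis
    unfolding gradient_def by (rule theI2)
qed

lemma has_real_derivative_along_line:
  fixes f :: "'a::euclidean_space \<Rightarrow> real"
  assumes "f differentiable (at (x + t *\<^sub>R h))"
  shows "((\<lambda>s. f (x + s *\<^sub>R h)) has_real_derivative gradient f (x + t *\<^sub>R h) \<bullet> h) (at t)"
proof -
  have "(f has_derivative (\<lambda>k. k \<bullet> gradient f (x + t *\<^sub>R h))) (at (x + t *\<^sub>R h))"
    using gderiv_gradient[OF assms] by (simp add: gderiv_def)
  moreover have "((\<lambda>s. x + s *\<^sub>R h) has_derivative (\<lambda>s. s *\<^sub>R h)) (at t)"
    by (auto intro!: derivative_eq_intros)
  ultimately have "((\<lambda>s. f (x + s *\<^sub>R h)) has_derivative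
      (\<lambda>s. (s *\<^sub>R h) \<bullet> gradient f (x + t *\<^sub>R h))) (at t)"
    by (rule has_derivative_compose[rotated])
  then show ?thesis
    by (simp add: has_field_derivative_def inner_commute mult_commute_abs)
qed

lemma convex_above_gradient:
  fixes f :: "'a::euclidean_space \<Rightarrow> real"
  assumes cvx: "convex_on UNIV f" and diff: "f differentiable (at x)"
  shows "f x + gradient f x \<bullet> (y - x) \<le> f y"
proof -
  have "convex_on UNIV (\<lambda>t. f (x + t *\<^sub>R (y - x)))"
  proof (rule convex_onI)
    fix t a b :: real
    assume "0 < t" "t < 1"
    have "x + ((1 - t) *\<^sub>R a + t *\<^sub>R b) *\<^sub>R (y - x) =
        (1 - t) *\<^sub>R (x + a *\<^sub>R (y - x)) + t *\<^sub>R (x + b *\<^sub>R (y - x))"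
      by (simp add: algebra_simps)
    then show "f (x + ((1 - t) *\<^sub>R a + t *\<^sub>R b) *\<^sub>R (y - x)) \<le>
        (1 - t) * f (x + a *\<^sub>R (y - x)) + t * f (x + b *\<^sub>R (y - x))"
      using convex_onD[OF cvx, of t "x + a *\<^sub>R (y - x)" "x + b *\<^sub>R (y - x)"] \<open>0 < t\<close> \<open>t < 1\<close>
      by simp
  qed simp
  moreover have "((\<lambda>t. f (x + t *\<^sub>R (y - x))) has_real_derivative gradient f x \<bullet> (y - x)) (at 0)"
    using has_real_derivative_along_line[of f x 0 "y - x"] diff by simp
  ultimately have "f (x + 1 *\<^sub>R (y - x)) - f (x + 0 *\<^sub>R (y - x)) \<ge> (gradient f x \<bullet> (y - x)) * (1 - 0)"
    by (intro convex_on_imp_above_tangent[where A = UNIV]) auto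
  then show ?thesis by simp
qed

text \<open>The Hoelder bound is assumed only along the segment from \<open>x\<close> to
  \<open>x + h\<close>, because block smoothness supplies it only for \<open>h\<close> in a single
  block. Instead of integrating, \<open>\<psi>\<close> subtracts the integrated bound from
  \<open>f\<close> and is shown to be nonincreasing.\<close>

lemma holder_descent:
  fixes f :: "'a::euclidean_space \<Rightarrow> real"
  assumes diff: "\<And>x. f differentiable (at x)" and "\<gamma> > 0"
    and K: "\<And>t. 0 < t \<Longrightarrow> t < 1 \<Longrightarrow>
      norm (gradient f (x + t *\<^sub>R h) - gradient f x) \<le> K * norm (t *\<^sub>R h) powr \<gamma>"
  shows "f (x + h) \<le> f x + gradient f x \<bullet> h + K / (1 + \<gamma>) * norm h powr (1 + \<gamma>)"
proof -
  define \<psi> where "\<psi> t = f (x + t *\<^sub>R h) - t * (gradient f x \<bullet> h)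
      - K / (1 + \<gamma>) * norm h powr (1 + \<gamma>) * t powr (1 + \<gamma>)" for t :: real
  have "\<psi> 1 \<le> \<psi> 0"
  \<comment> \<open>The derivative is asked for only in the open interval, where
    \<open>t > 0\<close> as the rule for \<open>powr\<close> requires; at the endpoints continuity
    is enough.\<close>
  proof (rule DERIV_nonpos_imp_decreasing_open[where f = \<psi>])
    fix t :: real
    assume t: "0 < t" "t < 1"
    let ?y = "(gradient f (x + t *\<^sub>R h) - gradient f x) \<bullet> h - K * norm h powr (1 + \<gamma>) * t powr \<gamma>"
    have "(\<psi> has_real_derivative gradient f (x + t *\<^sub>R h) \<bullet> h - gradient f x \<bullet> h
        - K / (1 + \<gamma>) * norm h powr (1 + \<gamma>) * ((1 + \<gamma>) * t powr \<gamma>)) (at t)"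
      unfolding \<psi>_def
      by (rule has_real_derivative_along_line[OF diff] derivative_eq_intros | use t in simp)+
    then have "(\<psi> has_real_derivative ?y) (at t)"
      using \<open>\<gamma> > 0\<close> by (simp add: inner_diff_left mult.assoc)
    moreover have "?y \<le> 0"
    proof -
      have "(gradient f (x + t *\<^sub>R h) - gradient f x) \<bullet> h
          \<le> norm (gradient f (x + t *\<^sub>R h) - gradient f x) * norm h"
        by (rule norm_cauchy_schwarz)
      also have "\<dots> \<le> K * norm (t *\<^sub>R h) powr \<gamma> * norm h"
        using K[OF t] by (rule mult_right_mono) simp
      also have "\<dots> = K * norm h powr (1 + \<gamma>) * t powr \<gamma>"
        using t by (cases "h = 0") (simp_all add: powr_mult powr_add)
      finally show ?thesis by simp
    qed
    ultimately show "\<exists>y. (\<psi> has_real_derivative y) (at t) \<and> y \<le> 0" by blast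
  next
    have "continuous_on {0..1} (\<lambda>t. f (x + t *\<^sub>R h))"
      using DERIV_isCont[OF has_real_derivative_along_line[OF diff]]
      by (intro continuous_at_imp_continuous_on) blast
    then show "continuous_on {0..1} \<psi>"
      unfolding \<psi>_def using \<open>\<gamma> > 0\<close>
      by (intro continuous_intros continuous_on_powr') auto
  qed simp
  then show ?thesis by (simp add: \<psi>_def)
qed

section \<open>Inequalities for real powers and for finite sums\<close>

lemma one_minus_le_powr_minus:
  fixes r p :: real
  assumes "r > 0" "p \<ge> 0"
  shows "1 - p * (r - 1) \<le> r powr (- p)"
proof -
  have "1 + (- p * ln r) \<le> exp (- p * ln r)" by (rule exp_ge_add_one_self)
  moreover have "p * ln r \<le> p * (r - 1)"
    using assms ln_le_minus_one by (intro mult_left_mono) auto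
  ultimately show ?thesis using assms by (simp add: powr_def)
qed

text \<open>Scaling by \<open>s\<close> reduces the claim to Bernoulli's inequality for
  \<open>r = t / s\<close>. For \<open>r > 0\<close> this is the previous bound at
  \<open>inverse r\<close> with \<open>p = \<nu> - 1\<close>, multiplied by
  \<open>r\<close>.\<close>

lemma powr_above_tangent:
  fixes s t \<nu> :: real
  assumes "s > 0" "t \<ge> 0" "\<nu> \<ge> 1"
  shows "s powr \<nu> + \<nu> * s powr (\<nu> - 1) * (t - s) \<le> t powr \<nu>"
proof -
  have *: "1 + \<nu> * (r - 1) \<le> r powr \<nu>" if "r \<ge> 0" for r
  proof (cases "r = 0")
    case False
    then have "r > 0" using that by simp
    have "r * (1 - (\<nu> - 1) * (inverse r - 1)) \<le> r * inverse r powr (- (\<nu> - 1))"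
      using \<open>r > 0\<close> assms by (intro mult_left_mono one_minus_le_powr_minus) auto
    also have "\<dots> = r powr \<nu>"
      using \<open>r > 0\<close> by (simp add: powr_diff powr_minus inverse_eq_divide powr_divide)
    also have "r * (1 - (\<nu> - 1) * (inverse r - 1)) = 1 + \<nu> * (r - 1)"
      using \<open>r > 0\<close> by (simp add: field_simps)
    finally show ?thesis .
  qed (use assms in simp)
  have "s powr \<nu> * (1 + \<nu> * (t / s - 1)) \<le> s powr \<nu> * (t / s) powr \<nu>"
    using assms by (intro mult_left_mono *) auto
  then show ?thesis using assms
    by (simp add: powr_divide powr_diff field_simps)
qed

text \<open>Young's inequality is summed after dividing \<open>u\<close> and \<open>v\<close> by
  their norms \<open>a\<close> and \<open>b\<close>; the bounds then add up to
  \<open>1 / p + 1 / q = 1\<close>. If one of the norms vanishes, so does every product.\<close>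

lemma Holder_sum:
  fixes u v :: "'i \<Rightarrow> real"
  assumes pq: "p > 1" "q > 1" "1 / p + 1 / q = 1"
    and "\<And>i. i \<in> A \<Longrightarrow> u i \<ge> 0" "\<And>i. i \<in> A \<Longrightarrow> v i \<ge> 0" "finite A"
  shows "(\<Sum>i\<in>A. u i * v i)
    \<le> (\<Sum>i\<in>A. u i powr p) powr (1 / p) * (\<Sum>i\<in>A. v i powr q) powr (1 / q)"
proof (cases "(\<Sum>i\<in>A. u i powr p) = 0 \<or> (\<Sum>i\<in>A. v i powr q) = 0")
  case True
  then have "(\<forall>i\<in>A. u i = 0) \<or> (\<forall>i\<in>A. v i = 0)"
    using \<open>finite A\<close> by (auto simp: sum_nonneg_eq_0_iff)
  then have "(\<Sum>i\<in>A. u i * v i) = 0" by (auto intro!: sum.neutral)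
  then show ?thesis by (metis mult_nonneg_nonneg powr_ge_zero)
next
  case False
  define a where "a = (\<Sum>i\<in>A. u i powr p) powr (1 / p)"
  define b where "b = (\<Sum>i\<in>A. v i powr q) powr (1 / q)"
  have pos: "a > 0" "b > 0"
    using False by (auto simp: a_def b_def)
  have ab: "a powr p = (\<Sum>i\<in>A. u i powr p)" "b powr q = (\<Sum>i\<in>A. v i powr q)"
    using pq by (auto simp: a_def b_def powr_powr sum_nonneg)
  have "(\<Sum>i\<in>A. (u i / a) * (v i / b)) \<le> (\<Sum>i\<in>A. (u i / a) powr p / p + (v i / b) powr q / q)"
    using assms pos by (intro sum_mono Youngs_inequality) auto
  also have "\<dots> = (\<Sum>i\<in>A. u i powr p) / a powr p / p + (\<Sum>i\<in>A. v i powr q) / b powr q / q"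
    using assms pos by (simp add: powr_divide sum.distrib sum_divide_distrib)
  also have "\<dots> = 1" using ab False pq by simp
  finally have "(\<Sum>i\<in>A. u i * v i) / (a * b) \<le> 1"
    by (simp add: sum_divide_distrib)
  then show ?thesis using pos by (simp add: a_def b_def field_simps)
qed

lemma min_value_coercive:
  fixes f :: "'a::euclidean_space \<Rightarrow> real"
  assumes cont: "continuous_on UNIV f" and "coercive f"
  obtains xs where "f xs = min_value f" and "\<And>y. min_value f \<le> f y"
proof -
  define S where "S = {x. f x \<le> f 0}"
  have "closed S" unfolding S_def
    using cont by (intro closed_Collect_le) auto
  then have "compact S"
    using \<open>coercive f\<close> by (simp add: compact_eq_bounded_closed coercive_def S_def)
  moreover have "S \<noteq> {}" by (auto simp: S_def)
  ultimately obtain xs where xs: "xs \<in> S" "\<And>y. y \<in> S \<Longrightarrow> f xs \<le> f y"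
    using continuous_attains_inf[of S f] cont continuous_on_subset by blast
  then have le: "f xs \<le> f y" for y
    using xs(1) xs(2)[of y] unfolding S_def mem_Collect_eq by linarith
  then have "min_value f = f xs"
    unfolding min_value_def by (intro Least_equality) auto
  then show thesis using that le by metis
qed

lemma rate_recurrence:
  fixes \<phi> :: "nat \<Rightarrow> real"
  assumes "\<nu> > 1" "C > 0" "B > 0" and nonneg: "\<And>k. \<phi> k \<ge> 0"
    and step: "\<And>k. \<phi> (Suc k) \<le> \<phi> k - \<phi> k powr \<nu> / C"
    and init: "\<phi> 0 \<le> (C / B) powr (1 / (\<nu> - 1))"
  shows "\<phi> k \<le> (C / (B + (\<nu> - 1) * real k)) powr (1 / (\<nu> - 1))"
proof -
  have B: "B + (\<nu> - 1) * real k > 0" for k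
    using \<open>B > 0\<close> \<open>\<nu> > 1\<close> by (simp add: add_pos_nonneg)
  \<comment> \<open>The case \<open>\<phi> k = 0\<close> is left out because
    \<open>0 powr (- (\<nu> - 1))\<close> is \<open>0\<close>, not infinity; the final bound is
    trivial there.\<close>
  have "\<phi> k > 0 \<longrightarrow> (B + (\<nu> - 1) * real k) / C \<le> \<phi> k powr (- (\<nu> - 1))"
  proof (induction k)
    case 0
    show ?case
    proof
      assume "\<phi> 0 > 0"
      then have "\<phi> 0 powr (\<nu> - 1) \<le> ((C / B) powr (1 / (\<nu> - 1))) powr (\<nu> - 1)"
        using \<open>\<nu> > 1\<close> init by (intro powr_mono2) auto
      also have "\<dots> = C / B" using assms(1-3) by (simp add: powr_powr)
      finally show "(B + (\<nu> - 1) * real 0) / C \<le> \<phi> 0 powr (- (\<nu> - 1))"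
        using assms(1-3) \<open>\<phi> 0 > 0\<close> unfolding powr_minus
        by (simp add: field_simps)
    qed
  next
    case (Suc k)
    show ?case
    proof
      assume pos': "\<phi> (Suc k) > 0"
      have pos: "\<phi> k > 0"
        using step[of k] pos' nonneg[of k] \<open>C > 0\<close> by (cases "\<phi> k = 0") auto
      define r where "r = \<phi> (Suc k) / \<phi> k"
      have "r > 0" using pos pos' by (simp add: r_def)
      have "\<phi> k powr \<nu> = \<phi> k powr (\<nu> - 1) * \<phi> k"
        using pos by (simp add: powr_diff)
      then have "r - 1 \<le> - (\<phi> k powr (\<nu> - 1) / C)"
        using step[of k] pos unfolding r_def by (simp add: field_simps)
      then have "(\<nu> - 1) * (r - 1) \<le> (\<nu> - 1) * - (\<phi> k powr (\<nu> - 1) / C)"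
        using \<open>\<nu> > 1\<close> by (intro mult_left_mono) auto
      \<comment> \<open>The bound for negative powers turns the relative decrease
        \<open>r - 1\<close> into growth. Multiplied by
        \<open>\<phi> k powr (- (\<nu> - 1))\<close>, the gain becomes
        \<open>(\<nu> - 1) / C\<close>, independent of \<open>k\<close>.\<close>
      then have "1 + (\<nu> - 1) * \<phi> k powr (\<nu> - 1) / C \<le> r powr (- (\<nu> - 1))"
        using one_minus_le_powr_minus[OF \<open>r > 0\<close>, of "\<nu> - 1"] \<open>\<nu> > 1\<close> by simp
      then have "\<phi> k powr (- (\<nu> - 1)) * (1 + (\<nu> - 1) * \<phi> k powr (\<nu> - 1) / C)
          \<le> \<phi> k powr (- (\<nu> - 1)) * r powr (- (\<nu> - 1))"
        by (intro mult_left_mono) auto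
      also have "\<dots> = \<phi> (Suc k) powr (- (\<nu> - 1))"
        using pos pos' by (simp add: r_def powr_mult[symmetric])
      also have "\<phi> k powr (- (\<nu> - 1)) * (1 + (\<nu> - 1) * \<phi> k powr (\<nu> - 1) / C)
          = \<phi> k powr (- (\<nu> - 1)) + (\<nu> - 1) / C"
        using pos unfolding powr_minus by (simp add: field_simps)
      finally have "\<phi> k powr (- (\<nu> - 1)) + (\<nu> - 1) / C \<le> \<phi> (Suc k) powr (- (\<nu> - 1))" .
      with Suc pos show "(B + (\<nu> - 1) * real (Suc k)) / C \<le> \<phi> (Suc k) powr (- (\<nu> - 1))"
        by (simp add: algebra_simps add_divide_distrib diff_divide_distrib)
    qed
  qed
  show ?thesis
  proof (cases "\<phi> k = 0")
    case False
    then have pos: "\<phi> k > 0" using nonneg[of k] by simp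
    then have "\<phi> k powr (\<nu> - 1) \<le> C / (B + (\<nu> - 1) * real k)"
      using \<open>\<phi> k > 0 \<longrightarrow> _\<close> B[of k] \<open>C > 0\<close> unfolding powr_minus
      by (simp add: field_simps)
    then have "(\<phi> k powr (\<nu> - 1)) powr (1 / (\<nu> - 1)) \<le> (C / (B + (\<nu> - 1) * real k)) powr (1 / (\<nu> - 1))"
      using \<open>\<nu> > 1\<close> by (intro powr_mono2) auto
    then show ?thesis using pos \<open>\<nu> > 1\<close> by (simp add: powr_powr)
  qed simp
qed

section \<open>Block decompositions, block norms and the level radius\<close>

lemma
  fixes P :: "'m::finite \<Rightarrow> real ^ 'd ^ 'd"
  assumes "block_decomposition P"
  shows block_idem: "P i *v (P i *v x) = P i *v x"
    and inner_block_left: "(P i *v x) \<bullet> y = x \<bullet> (P i *v y)"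
    and sum_blocks: "(\<Sum>i\<in>UNIV. P i *v x) = x"
    and inner_sum_blocks: "x \<bullet> y = (\<Sum>i\<in>UNIV. (P i *v x) \<bullet> (P i *v y))"
proof -
  have P: "P i ** P i = P i" "transpose (P i) = P i" for i
    using assms by (auto simp: block_decomposition_def orthogonal_projection_def)
  show idem: "P i *v (P i *v x) = P i *v x" for i x
    by (simp add: matrix_vector_mul_assoc P)
  show adj: "(P i *v x) \<bullet> y = x \<bullet> (P i *v y)" for i x y
    by (metis P(2) dot_lmul_matrix vector_transpose_matrix)
  \<comment> \<open>Distinct projections annihilate each other: in the squared norm of
    \<open>P i *v (P j *v x)\<close> self-adjointness moves the left \<open>P i\<close> across,
    which leaves an inner product of vectors from two orthogonal ranges.\<close>
  have orth: "P i *v (P j *v x) = 0" if "i \<noteq> j" for i j x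
  proof -
    have "(P i *v (P j *v x)) \<bullet> (P i *v (P j *v x)) = (P j *v x) \<bullet> (P i *v (P i *v (P j *v x)))"
      by (rule adj)
    also have "\<dots> = 0"
      using assms that by (auto simp: block_decomposition_def orthogonal_def)
    finally show ?thesis by simp
  qed
  show sum: "(\<Sum>i\<in>UNIV. P i *v x) = x" for x
  proof -
    \<comment> \<open>The part of \<open>x\<close> that the blocks miss. Every \<open>P j\<close>
      annihilates it, so it is orthogonal to all ranges and to their span, which contains
      \<open>z\<close> itself.\<close>
    define z where "z = x - (\<Sum>i\<in>UNIV. P i *v x)"
    have "P j *v z = 0" for j
    proof -
      have "P j *v (\<Sum>i\<in>UNIV. P i *v x) = (\<Sum>i\<in>UNIV. P j *v (P i *v x))"
        by (simp add: linear_sum[OF matrix_vector_mul_linear])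
      also have "\<dots> = (\<Sum>i\<in>UNIV. if i = j then P j *v x else 0)"
        using orth idem by (intro sum.cong) auto
      finally show ?thesis by (simp add: z_def matrix_vector_mult_diff_distrib)
    qed
    then have "orthogonal z y" if "y \<in> (\<Union>i. range (\<lambda>x. P i *v x))" for y
      using that by (auto simp: orthogonal_def adj[symmetric])
    then have "orthogonal z z"
      using assms by (intro orthogonal_to_span[of z "\<Union>i. range (\<lambda>x. P i *v x)"])
        (auto simp: block_decomposition_def)
    then show ?thesis by (simp add: orthogonal_self z_def)
  qed
  have "x \<bullet> y = (\<Sum>i\<in>UNIV. P i *v x) \<bullet> y" by (simp add: sum)
  also have "\<dots> = (\<Sum>i\<in>UNIV. (P i *v x) \<bullet> (P i *v y))"
    unfolding inner_sum_left by (simp add: adj idem)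
  finally show "x \<bullet> y = (\<Sum>i\<in>UNIV. (P i *v x) \<bullet> (P i *v y))" .
qed

lemma block_norm_nonneg: "block_norm P L a q x \<ge> 0"
  by (simp add: block_norm_def)

lemma continuous_on_block_norm:
  assumes "q > 0" "continuous_on S g"
  shows "continuous_on S (\<lambda>x. block_norm P L a q (g x))"
  unfolding block_norm_def using assms
  by (intro continuous_intros continuous_on_powr' ballI
      bounded_linear.continuous_on[OF matrix_vector_mul_bounded_linear])
    (auto intro!: sum_nonneg)

text \<open>\<open>GREATEST\<close> is a maximum only if one is attained. The minimizers form the
  sublevel set of \<open>min_value f\<close>, so the admissible pairs form a product
  \<open>K\<close> of two compact sets, and \<open>A\<close> is its continuous image.\<close>

lemma block_norm_le_level_radius:
  fixes f :: "real ^ 'd \<Rightarrow> real"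
  assumes cont: "continuous_on UNIV f" and coer: "coercive f" and "q > 0"
    and xs: "f xs = min_value f" and y: "f y \<le> f x"
  shows "block_norm P L a q (y - xs) \<le> level_radius P L f a q x"
proof -
  have compact: "compact {x. f x \<le> c}" for c
    using coer cont by (auto simp: compact_eq_bounded_closed coercive_def intro!: closed_Collect_le)
  have min: "min_value f \<le> f y" for y
    using min_value_coercive[OF cont coer] by metis
  define K where "K = {y. f y \<le> f x} \<times> {xs. f xs \<le> min_value f}"
  define A where "A = {block_norm P L a q (y - xs) |y xs. f xs = min_value f \<and> f y \<le> f x}"
  have A: "A = (\<lambda>(y, xs). block_norm P L a q (y - xs)) ` K"
    using min by (force simp: A_def K_def intro: antisym)
  have "compact A"
    unfolding A K_def case_prod_beta using \<open>q > 0\<close>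
    by (intro compact_continuous_image continuous_on_block_norm compact_Times compact
        continuous_intros)
  moreover have "block_norm P L a q (y - xs) \<in> A"
    using xs y by (auto simp: A_def)
  ultimately obtain r where r: "r \<in> A" "\<And>s. s \<in> A \<Longrightarrow> s \<le> r"
    using compact_attains_sup[of A] by blast
  then have "level_radius P L f a q x = r"
    unfolding level_radius_def A_def[symmetric] by (intro Greatest_equality)
  then show ?thesis
    using r(2) \<open>block_norm P L a q (y - xs) \<in> A\<close> by simp
qed

section \<open>Expectations along an iteration driven by independent choices from a finite
  set\<close>

lemma (in prob_space)
  fixes I :: "nat \<Rightarrow> 'a \<Rightarrow> 'm::finite" and T :: "'m \<Rightarrow> 'b \<Rightarrow> 'b" and \<phi> :: "'b \<Rightarrow> real"
  assumes indep: "indep_vars (\<lambda>_. count_space UNIV) I UNIV"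
    and X0: "\<And>w. w \<in> space M \<Longrightarrow> X 0 w = x0"
    and X_Suc: "\<And>k w. w \<in> space M \<Longrightarrow> X (Suc k) w = T (I k w) (X k w)"
  shows integrable_random_iteration: "integrable M (\<lambda>w. \<phi> (X k w))"
    and expectation_random_iteration_Suc: "expectation (\<lambda>w. \<phi> (X (Suc k) w)) =
      (\<Sum>i\<in>UNIV. prob {w \<in> space M. I k w = i} * expectation (\<lambda>w. \<phi> (T i (X k w))))"
proof -
  \<comment> \<open>The iterate as a function of the choices made so far: their space is finite, so every
    function on it is measurable.\<close>
  define G where "G = rec_nat (\<lambda>_. x0) (\<lambda>k g \<omega>. T (\<omega> k) (g \<omega>))"
  have G: "G 0 \<omega> = x0" "G (Suc k) \<omega> = T (\<omega> k) (G k \<omega>)" for k \<omega>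
    by (simp_all add: G_def)
  have G_cong: "G k \<omega> = G k \<omega>'" if "\<And>j. j < k \<Longrightarrow> \<omega> j = \<omega>' j" for k \<omega> \<omega>'
    using that by (induction k) (simp_all add: G)
  have XG: "X k w = G k (\<lambda>j\<in>{..<k}. I j w)" if "w \<in> space M" for k w
  proof -
    have "X k w = G k (\<lambda>j. I j w)"
      using that by (induction k) (simp_all add: G X0 X_Suc)
    also have "\<dots> = G k (\<lambda>j\<in>{..<k}. I j w)" by (rule G_cong) simp
    finally show ?thesis .
  qed
  have meas_I: "I k \<in> measurable M (count_space UNIV)" for k
    using indep by (simp add: indep_vars_def)
  have PiM_eq: "Pi\<^sub>M J (\<lambda>_. count_space (UNIV :: 'm set)) = count_space (PiE J (\<lambda>_. UNIV))"
    if "finite J" for J :: "nat set"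
    using that by (intro count_space_PiM_finite) auto
  have meas_hist: "(\<lambda>w. \<lambda>j\<in>{..<k}. I j w)
      \<in> measurable M (count_space (PiE {..<k} (\<lambda>_. UNIV :: 'm set)))" for k
    using meas_I by (subst PiM_eq[symmetric]) (auto intro!: measurable_restrict)
  have int: "integrable M (\<lambda>w. \<psi> (X k w))" for \<psi> :: "'b \<Rightarrow> real" and k
  proof -
    let ?E = "PiE {..<k} (\<lambda>_. UNIV :: 'm set)"
    let ?B = "Max ((\<lambda>\<omega>. norm (\<psi> (G k \<omega>))) ` ?E)"
    have fin: "finite ?E" by (intro finite_PiE) auto
    have "integrable M (\<lambda>w. \<psi> (G k (\<lambda>j\<in>{..<k}. I j w)))"
    proof (rule integrable_const_bound)
      show "AE w in M. norm (\<psi> (G k (\<lambda>j\<in>{..<k}. I j w))) \<le> ?B"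
        using fin by (auto intro!: Max_ge)
      show "(\<lambda>w. \<psi> (G k (\<lambda>j\<in>{..<k}. I j w))) \<in> borel_measurable M"
        by (rule measurable_compose[OF meas_hist]) simp
    qed
    then show ?thesis by (simp add: XG cong: Bochner_Integration.integrable_cong)
  qed
  show "integrable M (\<lambda>w. \<phi> (X k w))" by (rule int)
  have prod: "expectation (\<lambda>w. \<phi> (T i (X k w)) * indicator {i} (I k w)) =
      expectation (\<lambda>w. \<phi> (T i (X k w))) * prob {w \<in> space M. I k w = i}"
    and int_prod: "integrable M (\<lambda>w. \<phi> (T i (X k w)) * indicator {i} (I k w))" for i
  proof -
    let ?U = "\<lambda>w. \<phi> (T i (G k (\<lambda>j\<in>{..<k}. I j w)))"
    let ?V = "\<lambda>w. indicator {i} (I k w) :: real"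
    \<comment> \<open>The history on \<open>{..<k}\<close> and the choice on \<open>{k}\<close>
      restrict the independent family \<open>I\<close> to disjoint index sets, so functions of them
      are independent and the expectation of the product factors.\<close>
    have "indep_var borel ((\<lambda>\<omega>. \<phi> (T i (G k \<omega>))) \<circ> (\<lambda>w. \<lambda>j\<in>{..<k}. I j w))
        borel ((\<lambda>\<omega>. indicator {i} (\<omega> k)) \<circ> (\<lambda>w. \<lambda>j\<in>{k}. I j w))"
      by (rule indep_var_compose[OF indep_var_restrict[OF indep]]) (auto simp: PiM_eq)
    then have ind: "indep_var borel ?U borel ?V"
      by (simp add: o_def)
    have intU: "integrable M ?U"
      using int[of "\<lambda>x. \<phi> (T i x)" k] by (simp add: XG cong: Bochner_Integration.integrable_cong)
    have set: "{w \<in> space M. I k w = i} \<in> events"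
      using measurable_sets[OF meas_I[of k], of "{i}"] by (simp add: vimage_def Int_def conj_commute)
    have V: "?V w = indicator {w \<in> space M. I k w = i} w" if "w \<in> space M" for w
      using that by (auto simp: indicator_def)
    have intV: "integrable M ?V"
      using set by (subst Bochner_Integration.integrable_cong[OF refl V]) (auto simp: emeasure_eq_measure)
    have "expectation ?V = prob {w \<in> space M. I k w = i}"
      using set by (subst Bochner_Integration.integral_cong[OF refl V]) auto
    with indep_var_lebesgue_integral[OF ind intU intV] indep_var_integrable[OF ind intU intV]
    show "expectation (\<lambda>w. \<phi> (T i (X k w)) * indicator {i} (I k w)) =
        expectation (\<lambda>w. \<phi> (T i (X k w))) * prob {w \<in> space M. I k w = i}"
      and "integrable M (\<lambda>w. \<phi> (T i (X k w)) * indicator {i} (I k w))"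
      by (simp_all add: XG cong: Bochner_Integration.integrable_cong Bochner_Integration.integral_cong)
  qed
  \<comment> \<open>The expectation is split by the value of \<open>I k\<close>: at each
    \<open>w\<close> exactly one indicator is \<open>1\<close>.\<close>
  have "expectation (\<lambda>w. \<phi> (X (Suc k) w)) =
      expectation (\<lambda>w. \<Sum>i\<in>UNIV. \<phi> (T i (X k w)) * indicator {i} (I k w))"
    by (intro Bochner_Integration.integral_cong) (simp_all add: X_Suc indicator_def)
  also have "\<dots> = (\<Sum>i\<in>UNIV. expectation (\<lambda>w. \<phi> (T i (X k w)) * indicator {i} (I k w)))"
    by (intro Bochner_Integration.integral_sum int_prod)
  finally show "expectation (\<lambda>w. \<phi> (X (Suc k) w)) =
      (\<Sum>i\<in>UNIV. prob {w \<in> space M. I k w = i} * expectation (\<lambda>w. \<phi> (T i (X k w))))"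
    by (simp add: prod mult.commute)
qed

section \<open>Deterministic estimates: decrease in one step and bounds on the gap\<close>

locale block_holder_problem =
  fixes P :: "'m::finite \<Rightarrow> real ^ 'd ^ 'd" and L :: "'m \<Rightarrow> real" and f :: "real ^ 'd \<Rightarrow> real"
    and \<alpha> \<gamma> \<nu> :: real
  assumes blocks: "block_decomposition P"
    and differentiable: "\<And>x. f differentiable (at x)"
    and convex: "convex_on UNIV f"
    and smooth: "block_holder_smooth P L \<gamma> f"
    and gamma: "0 < \<gamma>" "\<gamma> \<le> 1"
    and nu: "\<nu> = (1 + \<gamma>) / \<gamma>"
begin

abbreviation "g \<equiv> block_gradient P f"

definition step :: "'m \<Rightarrow> real ^ 'd \<Rightarrow> real ^ 'd" where
  "step i x = x - (norm (g i x) powr (\<nu> - 2) / L i powr (\<nu> - 1)) *\<^sub>R g i x"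

text \<open>The \<open>\<nu>\<close>-th power of the block norm of the gradient with parameters
  \<open>1 + \<alpha> - \<nu>\<close> and \<open>\<nu>\<close>. The root is not taken because the
  expected decrease is linear in this power.\<close>

definition weighted_gradient :: "real ^ 'd \<Rightarrow> real" where
  "weighted_gradient x = (\<Sum>i\<in>UNIV. L i powr (1 + \<alpha> - \<nu>) * norm (g i x) powr \<nu>)"

lemma L_pos: "L i > 0"
  using smooth by (simp add: block_holder_smooth_def)

lemma nu_gt_1: "\<nu> > 1" and nu_minus_1: "\<nu> - 1 = 1 / \<gamma>" and conjugate: "\<nu> / (\<nu> - 1) = 1 + \<gamma>"
  using gamma by (auto simp: nu field_simps)

lemma S_sum_pos: "S_sum L \<alpha> > 0"
  unfolding S_sum_def using L_pos by (intro sum_pos) (auto simp: less_imp_neq[symmetric])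

lemma block_descent:
  "f (x + P i *v u) \<le> f x + gradient f x \<bullet> (P i *v u) + L i / (1 + \<gamma>) * norm (P i *v u) powr (1 + \<gamma>)"
proof (rule holder_descent[OF differentiable gamma(1)])
  fix t :: real
  have "norm (gradient f (x + P i *v (t *\<^sub>R u)) - gradient f x) \<le> L i * norm (P i *v (t *\<^sub>R u)) powr \<gamma>"
    using smooth by (simp only: block_holder_smooth_def)
  then show "norm (gradient f (x + t *\<^sub>R (P i *v u)) - gradient f x)
      \<le> L i * norm (t *\<^sub>R (P i *v u)) powr \<gamma>"
    by (simp only: matrix_vector_mult_scaleR)
qed

text \<open>The step length minimizes the descent bound along \<open>- g i x\<close>: for a
  displacement of length \<open>s\<close> and \<open>n = norm (g i x)\<close>, the minimum of
  \<open>L i / (1 + \<gamma>) * s powr (1 + \<gamma>) - n * s\<close> is at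
  \<open>s = (n / L i) powr (\<nu> - 1)\<close>. The remainder is then
  \<open>1 / (1 + \<gamma>)\<close> times the linear gain, which leaves the fraction
  \<open>1 / \<nu>\<close> of it.\<close>

lemma step_decrease:
  "f (step i x) \<le> f x - norm (g i x) powr \<nu> / (\<nu> * L i powr (\<nu> - 1))"
proof (cases "g i x = 0")
  case True
  then show ?thesis by (simp add: step_def)
next
  case False
  define n where "n = norm (g i x)"
  define c where "c = n powr (\<nu> - 2) / L i powr (\<nu> - 1)"
  define u where "u = (- c) *\<^sub>R g i x"
  have n: "n > 0" and Li: "L i > 0"
    using False L_pos by (auto simp: n_def)
  have "P i *v g i x = g i x"
    by (simp add: block_gradient_def block_idem[OF blocks])
  then have u: "P i *v u = u"
    by (simp only: u_def matrix_vector_mult_scaleR)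
  have step: "step i x = x + P i *v u"
    unfolding u by (simp add: step_def u_def c_def n_def)
  have "gradient f x \<bullet> g i x = n powr 2"
    using n inner_block_left[OF blocks, of i "gradient f x" "g i x"]
    by (simp add: block_gradient_def n_def block_idem[OF blocks] power2_norm_eq_inner)
  then have inner: "gradient f x \<bullet> (P i *v u) = - (n powr \<nu> / L i powr (\<nu> - 1))"
    unfolding u using n by (simp add: u_def c_def powr_diff)
  have "norm (P i *v u) = n powr (\<nu> - 1) / L i powr (\<nu> - 1)"
    unfolding u using n by (simp add: u_def c_def powr_diff n_def[symmetric] power2_eq_square)
  moreover have "(\<nu> - 1) * (1 + \<gamma>) = \<nu>"
    unfolding conjugate[symmetric] using nu_gt_1 by simp
  ultimately have norm: "norm (P i *v u) powr (1 + \<gamma>) = n powr \<nu> / L i powr \<nu>"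
    using n Li by (simp add: powr_divide powr_powr)
  have "f (step i x) \<le> f x - n powr \<nu> / L i powr (\<nu> - 1)
      + L i / (1 + \<gamma>) * (n powr \<nu> / L i powr \<nu>)"
    using block_descent[of x i u] unfolding step inner norm by simp
  also have "L i / (1 + \<gamma>) * (n powr \<nu> / L i powr \<nu>) = n powr \<nu> / L i powr (\<nu> - 1) / (1 + \<gamma>)"
    using Li by (simp add: powr_diff mult_ac)
  also have "f x - n powr \<nu> / L i powr (\<nu> - 1) + n powr \<nu> / L i powr (\<nu> - 1) / (1 + \<gamma>)
      = f x - n powr \<nu> / L i powr (\<nu> - 1) * (1 / \<nu>)"
    using gamma by (simp add: nu divide_simps) (simp add: algebra_simps)
  finally show ?thesis by (simp add: n_def mult.commute)
qed

lemma step_le: "f (step i x) \<le> f x"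
proof -
  have "norm (g i x) powr \<nu> / (\<nu> * L i powr (\<nu> - 1)) \<ge> 0"
    using nu_gt_1 by simp
  then show ?thesis using step_decrease[of i x] by linarith
qed

text \<open>The sampling weight \<open>L i powr \<alpha>\<close> and the divisor
  \<open>L i powr (\<nu> - 1)\<close> of the one-step decrease combine to the weight in
  \<open>weighted_gradient\<close>.\<close>

lemma expected_step_decrease:
  "(\<Sum>i\<in>UNIV. L i powr \<alpha> / S_sum L \<alpha> * f (step i x)) \<le> f x - weighted_gradient x / (\<nu> * S_sum L \<alpha>)"
proof -
  have "(\<Sum>i\<in>UNIV. L i powr \<alpha> / S_sum L \<alpha> * f (step i x))
      \<le> (\<Sum>i\<in>UNIV. L i powr \<alpha> / S_sum L \<alpha> * (f x - norm (g i x) powr \<nu> / (\<nu> * L i powr (\<nu> - 1))))"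
    using S_sum_pos by (intro sum_mono mult_left_mono step_decrease) auto
  also have "\<dots> = (\<Sum>i\<in>UNIV. L i powr \<alpha> / S_sum L \<alpha> * f x
      - L i powr (1 + \<alpha> - \<nu>) * norm (g i x) powr \<nu> / (\<nu> * S_sum L \<alpha>))"
  proof (rule sum.cong[OF refl])
    fix i
    have "L i powr (1 + \<alpha> - \<nu>) = L i powr \<alpha> / L i powr (\<nu> - 1)"
      using L_pos[of i] by (simp add: powr_diff powr_add)
    then show "L i powr \<alpha> / S_sum L \<alpha> * (f x - norm (g i x) powr \<nu> / (\<nu> * L i powr (\<nu> - 1)))
      = L i powr \<alpha> / S_sum L \<alpha> * f x
        - L i powr (1 + \<alpha> - \<nu>) * norm (g i x) powr \<nu> / (\<nu> * S_sum L \<alpha>)"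
      by (simp add: algebra_simps)
  qed
  also have "\<dots> = (\<Sum>i\<in>UNIV. L i powr \<alpha>) / S_sum L \<alpha> * f x - weighted_gradient x / (\<nu> * S_sum L \<alpha>)"
    by (simp add: sum_subtractf weighted_gradient_def sum_divide_distrib sum_distrib_right)
  also have "(\<Sum>i\<in>UNIV. L i powr \<alpha>) / S_sum L \<alpha> = 1"
    using S_sum_pos by (simp add: S_sum_def)
  finally show ?thesis by simp
qed

text \<open>Convexity, Cauchy-Schwarz within each block and Hoelder's inequality across blocks. The
  factors \<open>L i powr b\<close> and \<open>L i powr (- b)\<close> cancel in each product;
  \<open>b\<close> is chosen to make the first sum \<open>weighted_gradient\<close>, and the
  conjugate exponent then forces the weight \<open>(1 + \<alpha> - \<nu>) / (1 - \<nu>)\<close> in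
  the second.\<close>

lemma gap_le_weighted_gradient:
  "f x - f y \<le> weighted_gradient x powr (1 / \<nu>)
    * block_norm P L ((1 + \<alpha> - \<nu>) / (1 - \<nu>)) (\<nu> / (\<nu> - 1)) (x - y)"
proof -
  define b where "b = (1 + \<alpha> - \<nu>) / \<nu>"
  define q where "q = \<nu> / (\<nu> - 1)"
  define u where "u i = L i powr b * norm (g i x)" for i
  define v where "v i = L i powr (- b) * norm (P i *v (x - y))" for i
  have q: "q > 1" "1 / \<nu> + 1 / q = 1"
    using nu_gt_1 by (auto simp: q_def field_simps)
  have bq: "b * \<nu> = 1 + \<alpha> - \<nu>" "- b * q = (1 + \<alpha> - \<nu>) / (1 - \<nu>)"
    using nu_gt_1 by (auto simp: b_def q_def divide_simps) (simp add: algebra_simps)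
  have "f x - f y \<le> gradient f x \<bullet> (x - y)"
    using convex_above_gradient[OF convex differentiable, of x y] by (simp add: inner_diff_right)
  also have "\<dots> = (\<Sum>i\<in>UNIV. g i x \<bullet> (P i *v (x - y)))"
    by (simp add: inner_sum_blocks[OF blocks, of "gradient f x"] block_gradient_def)
  also have "\<dots> \<le> (\<Sum>i\<in>UNIV. norm (g i x) * norm (P i *v (x - y)))"
    by (intro sum_mono norm_cauchy_schwarz)
  also have "\<dots> = (\<Sum>i\<in>UNIV. u i * v i)"
    using L_pos by (intro sum.cong) (auto simp: u_def v_def powr_minus less_imp_neq[symmetric])
  also have "\<dots> \<le> (\<Sum>i\<in>UNIV. u i powr \<nu>) powr (1 / \<nu>) * (\<Sum>i\<in>UNIV. v i powr q) powr (1 / q)"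
    using nu_gt_1 q by (intro Holder_sum) (auto simp: u_def v_def)
  also have "(\<Sum>i\<in>UNIV. u i powr \<nu>) = weighted_gradient x"
    by (simp add: u_def weighted_gradient_def powr_mult powr_powr bq)
  also have "(\<Sum>i\<in>UNIV. v i powr q) powr (1 / q) = block_norm P L (- b * q) q (x - y)"
    by (simp only: v_def block_norm_def powr_mult powr_powr)
  finally show ?thesis unfolding bq(2) by (simp only: q_def)
qed

lemma gap_powr_le_weighted_gradient:
  assumes "f y \<le> f x"
    and R: "block_norm P L ((1 + \<alpha> - \<nu>) / (1 - \<nu>)) (\<nu> / (\<nu> - 1)) (x - y) \<le> R"
  shows "(f x - f y) powr \<nu> \<le> weighted_gradient x * R powr \<nu>"
proof -
  have nonneg: "weighted_gradient x \<ge> 0" "R \<ge> 0"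
    using order_trans[OF block_norm_nonneg R] by (auto simp: weighted_gradient_def intro!: sum_nonneg)
  have "f x - f y \<le> weighted_gradient x powr (1 / \<nu>) * R"
    using gap_le_weighted_gradient[of x y] mult_left_mono[OF R, of "weighted_gradient x powr (1 / \<nu>)"]
    by simp
  then have "(f x - f y) powr \<nu> \<le> (weighted_gradient x powr (1 / \<nu>) * R) powr \<nu>"
    using assms nu_gt_1 by (intro powr_mono2) auto
  also have "\<dots> = weighted_gradient x * R powr \<nu>"
    using nonneg nu_gt_1 by (simp add: powr_mult powr_powr)
  finally show ?thesis .
qed

text \<open>With weights \<open>p i = L i powr \<alpha> / S\<close>, the point \<open>x\<close> is the average of the points
  \<open>xs + P i *v (x - xs) /\<^sub>R p i\<close>, each of which differs from \<open>xs\<close> in a single block.\<close>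

lemma gap_le_block_norm:
  assumes min: "\<And>y. f xs \<le> f y"
    and R: "block_norm P L ((1 + \<alpha> - \<nu>) / (1 - \<nu>)) (\<nu> / (\<nu> - 1)) (x - xs) \<le> R"
  shows "f x - f xs \<le> S_sum L \<alpha> powr \<gamma> * R powr (1 + \<gamma>) / (1 + \<gamma>)"
proof -
  define S where "S = S_sum L \<alpha>"
  define p where "p i = L i powr \<alpha> / S" for i
  have S: "S > 0" by (simp add: S_def S_sum_pos)
  have p: "p i > 0" for i
    using S L_pos[of i] by (simp add: p_def)
  have sum_p: "(\<Sum>i\<in>UNIV. p i) = 1"
    using S by (simp add: p_def S_def S_sum_def sum_divide_distrib[symmetric])
  define h where "h i = P i *v ((1 / p i) *\<^sub>R (x - xs))" for i
  have h: "p i *\<^sub>R h i = P i *v (x - xs)" for i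
    using p[of i] by (simp only: h_def matrix_vector_mult_scaleR) simp
  \<comment> \<open>The linear term of the descent bound around the minimizer \<open>xs\<close>
    vanishes.\<close>
  have grad0: "gradient f xs = 0"
  proof -
    have "gradient f xs \<bullet> d = 0" for d
    proof (rule DERIV_local_min)
      show "((\<lambda>s. f (xs + s *\<^sub>R d)) has_real_derivative gradient f xs \<bullet> d) (at 0)"
        using has_real_derivative_along_line[of f xs 0 d] differentiable by simp
      show "\<forall>s. \<bar>0 - s\<bar> < 1 \<longrightarrow> f (xs + 0 *\<^sub>R d) \<le> f (xs + s *\<^sub>R d)"
        using min by simp
    qed simp
    then show ?thesis using inner_eq_zero_iff by blast
  qed
  have a: "(1 + \<alpha> - \<nu>) / (1 - \<nu>) = 1 - \<alpha> * \<gamma>"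
    using gamma by (simp add: nu field_simps)
  have "(\<Sum>i\<in>UNIV. p i *\<^sub>R (xs + h i)) = (\<Sum>i\<in>UNIV. p i) *\<^sub>R xs + (\<Sum>i\<in>UNIV. P i *v (x - xs))"
    by (simp add: scaleR_add_right sum.distrib scaleR_sum_left h)
  also have "\<dots> = x" by (simp add: sum_p sum_blocks[OF blocks])
  finally have "f x \<le> (\<Sum>i\<in>UNIV. p i * f (xs + h i))"
    using convex_on_sum[OF finite UNIV_not_empty convex sum_p, of "\<lambda>i. xs + h i"] p
    by (simp add: less_imp_le)
  also have "\<dots> \<le> (\<Sum>i\<in>UNIV. p i * (f xs + L i / (1 + \<gamma>) * norm (h i) powr (1 + \<gamma>)))"
    using block_descent[of xs] p grad0
    by (intro sum_mono mult_left_mono) (simp_all add: h_def less_imp_le)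
  also have "\<dots> = (\<Sum>i\<in>UNIV. p i * f xs
      + S powr \<gamma> / (1 + \<gamma>) * (L i powr (1 - \<alpha> * \<gamma>) * norm (P i *v (x - xs)) powr (1 + \<gamma>)))"
  proof (rule sum.cong[OF refl])
    fix i
    \<comment> \<open>Rescaling the block by \<open>1 / p i\<close> costs a net factor
      \<open>p i powr (- \<gamma>)\<close>, that is
      \<open>S powr \<gamma> * L i powr (- (\<alpha> * \<gamma>))\<close>. Times \<open>L i\<close>
      this gives the exponent \<open>1 - \<alpha> * \<gamma>\<close> of the block norm.\<close>
    have "norm (P i *v (x - xs)) = p i * norm (h i)"
      unfolding h[symmetric] using p[of i] by simp
    then have n: "norm (P i *v (x - xs)) powr (1 + \<gamma>) = p i powr \<gamma> * p i * norm (h i) powr (1 + \<gamma>)"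
      using p[of i] by (simp add: powr_mult powr_add)
    have "p i powr \<gamma> = L i powr (\<alpha> * \<gamma>) / S powr \<gamma>"
      using S by (simp add: p_def powr_divide powr_powr)
    then have "S powr \<gamma> * (L i powr (1 - \<alpha> * \<gamma>) * p i powr \<gamma>) = L i"
      using L_pos[of i] S by (simp add: powr_diff)
    then have eq: "S powr \<gamma> / (1 + \<gamma>) * (L i powr (1 - \<alpha> * \<gamma>) * norm (P i *v (x - xs)) powr (1 + \<gamma>))
        = L i / (1 + \<gamma>) * (p i * norm (h i) powr (1 + \<gamma>))"
      unfolding n by (simp add: mult_ac)
    show "p i * (f xs + L i / (1 + \<gamma>) * norm (h i) powr (1 + \<gamma>)) = p i * f xs
      + S powr \<gamma> / (1 + \<gamma>) * (L i powr (1 - \<alpha> * \<gamma>) * norm (P i *v (x - xs)) powr (1 + \<gamma>))"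
      unfolding eq by (simp add: algebra_simps)
  qed
  also have "\<dots> = f xs + S powr \<gamma> / (1 + \<gamma>) *
      (\<Sum>i\<in>UNIV. L i powr (1 - \<alpha> * \<gamma>) * norm (P i *v (x - xs)) powr (1 + \<gamma>))"
    unfolding sum.distrib sum_distrib_left[symmetric] sum_distrib_right[symmetric] sum_p by simp
  also have "(\<Sum>i\<in>UNIV. L i powr (1 - \<alpha> * \<gamma>) * norm (P i *v (x - xs)) powr (1 + \<gamma>))
      = block_norm P L (1 - \<alpha> * \<gamma>) (1 + \<gamma>) (x - xs) powr (1 + \<gamma>)"
    using gamma by (simp add: block_norm_def powr_powr sum_nonneg)
  also have "f xs + S powr \<gamma> / (1 + \<gamma>) * \<dots> \<le> f xs + S powr \<gamma> / (1 + \<gamma>) * R powr (1 + \<gamma>)"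
    using R gamma block_norm_nonneg unfolding a conjugate
    by (intro add_left_mono mult_left_mono powr_mono2) auto
  finally show ?thesis by (simp add: S_def)
qed

end

section \<open>The expected gap of the random iterates and its rate\<close>

theorem theorem4p5p3:
  fixes P :: "'m::finite \<Rightarrow> real ^ 'd ^ 'd"
    and L :: "'m \<Rightarrow> real"
    and f :: "real ^ 'd \<Rightarrow> real"
    and \<alpha> \<gamma> \<nu> R :: real
    and x0 :: "real ^ 'd"
    and M :: "'w measure"
    and I :: "nat \<Rightarrow> 'w \<Rightarrow> 'm"
    and X :: "nat \<Rightarrow> 'w \<Rightarrow> real ^ 'd"
  assumes "block_decomposition P"
    and "\<alpha> \<in> {0..1}"
    and "\<gamma> \<in> {0<..1}"
    and "continuously_differentiable f"
    and "convex_on UNIV f"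
    and "coercive f"
    and "holder_smooth \<gamma> f"
    and "block_holder_smooth P L \<gamma> f"
    and "\<nu> = (1 + \<gamma>) / \<gamma>"
    and "R = level_radius P L f ((1 + \<alpha> - \<nu>) / (1 - \<nu>)) (\<nu> / (\<nu> - 1)) x0"
    and "RBCD M P L f \<nu> \<alpha> x0 I X"
  shows "(\<forall>k. prob_space.expectation M (\<lambda>w. f (X k w)) - min_value f
            \<le> (\<nu> * S_sum L \<alpha> * R powr \<nu>) powr (1 / (\<nu> - 1)) * (\<nu> - 1)
              / (2 * \<nu> powr (\<nu> - 1) + (\<nu> - 1) powr \<nu> * real k) powr (1 / (\<nu> - 1)))
       \<and> (\<lambda>k. (\<nu> * S_sum L \<alpha> * R powr \<nu>) powr (1 / (\<nu> - 1)) * (\<nu> - 1)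
              / (2 * \<nu> powr (\<nu> - 1) + (\<nu> - 1) powr \<nu> * real k) powr (1 / (\<nu> - 1)))
           \<in> O(\<lambda>k. real k powr (- 1 / (\<nu> - 1)))"
proof -
  have differentiable: "\<And>x. f differentiable (at x)"
    using assms(4) by (simp add: continuously_differentiable_def)
  interpret block_holder_problem P L f \<alpha> \<gamma> \<nu>
    using assms differentiable by unfold_locales auto
  have rbcd: "prob_space M"
    "prob_space.indep_vars M (\<lambda>_. count_space UNIV) I UNIV"
    "\<And>k i. measure M {w \<in> space M. I k w = i} = L i powr \<alpha> / S_sum L \<alpha>"
    "\<And>w. w \<in> space M \<Longrightarrow> X 0 w = x0"
    "\<And>k w. w \<in> space M \<Longrightarrow> X (Suc k) w = step (I k w) (X k w)"
    using assms(11) by (simp_all add: RBCD_def S_sum_def step_def)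
  interpret prob_space M by (rule rbcd(1))
  have cont: "continuous_on UNIV f"
    using differentiable by (simp add: continuous_at_imp_continuous_on differentiable_imp_continuous_within)
  obtain xs where xs: "f xs = min_value f" and min: "\<And>y. min_value f \<le> f y"
    using min_value_coercive[OF cont assms(6)] by metis
  define gap where "gap x = f x - min_value f" for x
  define \<phi> where "\<phi> k = expectation (\<lambda>w. gap (X k w))" for k
  define C where "C = \<nu> * S_sum L \<alpha> * R powr \<nu>"
  \<comment> \<open>Chosen so that the denominator under the root is
    \<open>(\<nu> - 1) powr (\<nu> - 1) * (B + (\<nu> - 1) * real k)\<close>; the root of the first
    factor cancels the \<open>\<nu> - 1\<close> in the numerator.\<close>
  define B where "B = 2 * (\<nu> / (\<nu> - 1)) powr (\<nu> - 1)"
  note S = S_sum_pos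
  have gap_nonneg: "gap x \<ge> 0" for x
    using min by (simp add: gap_def)
  have q: "\<nu> / (\<nu> - 1) > 0" using nu_gt_1 by simp
  have radius: "block_norm P L ((1 + \<alpha> - \<nu>) / (1 - \<nu>)) (\<nu> / (\<nu> - 1)) (x - xs) \<le> R"
    if "f x \<le> f x0" for x
    unfolding assms(10) using cont assms(6) q xs that by (rule block_norm_le_level_radius)
  have "R \<ge> 0"
    using radius[of x0] order_trans[OF block_norm_nonneg] by blast
  \<comment> \<open>The decrease holds on every path, not only on average, so the single radius
    \<open>R\<close> serves all iterates.\<close>
  have level: "f (X k w) \<le> f x0" if "w \<in> space M" for k w
    using that
  proof (induction k)
    case (Suc k)
    then show ?case using step_le[of "I k w" "X k w"] by (simp add: rbcd)
  qed (simp add: rbcd)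
  have int: "integrable M (\<lambda>w. h (X k w))" for h :: "_ \<Rightarrow> real" and k
    using rbcd(2,4,5) by (rule integrable_random_iteration)
  have \<phi>_nonneg: "\<phi> k \<ge> 0" for k
    unfolding \<phi>_def using gap_nonneg by (intro Bochner_Integration.integral_nonneg) auto
  have \<phi>_eq: "expectation (\<lambda>w. f (X k w)) - min_value f = \<phi> k" for k
    using int[of f k] by (simp add: \<phi>_def gap_def prob_space)
  have \<phi>_init: "\<phi> 0 \<le> S_sum L \<alpha> powr \<gamma> * R powr (1 + \<gamma>) / (1 + \<gamma>)"
  proof -
    have "\<phi> 0 = gap x0"
      unfolding \<phi>_def by (simp add: rbcd(4) prob_space cong: Bochner_Integration.integral_cong)
    then show ?thesis
      using gap_le_block_norm[of xs x0 R] radius min xs by (simp add: gap_def)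
  qed
  have \<phi>_le_init: "\<phi> k \<le> \<phi> 0" for k
    unfolding \<phi>_def using level
    by (intro integral_mono int) (simp_all add: gap_def rbcd(4))
  have \<phi>_step: "\<phi> (Suc k) \<le> \<phi> k - \<phi> k powr \<nu> / C" if "R > 0" for k
  proof -
    have "C > 0" using nu_gt_1 S that by (simp add: C_def)
    have point: "(\<Sum>i\<in>UNIV. L i powr \<alpha> / S_sum L \<alpha> * gap (step i x)) \<le> gap x - gap x powr \<nu> / C"
      if "f x \<le> f x0" for x
    proof -
      have "gap x powr \<nu> / R powr \<nu> \<le> weighted_gradient x"
        using gap_powr_le_weighted_gradient[of xs x R] radius[OF that] min xs \<open>R > 0\<close>
        by (simp add: gap_def divide_le_eq)
      then have "gap x powr \<nu> / R powr \<nu> / (\<nu> * S_sum L \<alpha>) \<le> weighted_gradient x / (\<nu> * S_sum L \<alpha>)"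
        using nu_gt_1 S by (intro divide_right_mono) auto
      moreover have "(\<Sum>i\<in>UNIV. L i powr \<alpha> / S_sum L \<alpha> * gap (step i x))
          = (\<Sum>i\<in>UNIV. L i powr \<alpha> / S_sum L \<alpha> * f (step i x)) - min_value f"
        using S by (simp add: gap_def right_diff_distrib sum_subtractf
            sum_distrib_right[symmetric] sum_divide_distrib[symmetric] S_sum_def[symmetric])
      ultimately show ?thesis
        using expected_step_decrease[of x] by (simp add: gap_def C_def mult_ac)
    qed
    \<comment> \<open>Jensen's inequality from the tangent of
      \<open>\<lambda>t. t powr \<nu>\<close> at the mean \<open>\<phi> k\<close>, whose linear part
      has expectation \<open>0\<close>. For mean \<open>0\<close> the left side is
      \<open>0\<close>.\<close>
    have jensen: "\<phi> k powr \<nu> \<le> expectation (\<lambda>w. gap (X k w) powr \<nu>)"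
    proof (cases "\<phi> k = 0")
      case False
      then have pos: "\<phi> k > 0" using \<phi>_nonneg[of k] by simp
      have "expectation (\<lambda>w. \<phi> k powr \<nu> + \<nu> * \<phi> k powr (\<nu> - 1) * (gap (X k w) - \<phi> k))
          \<le> expectation (\<lambda>w. gap (X k w) powr \<nu>)"
        using powr_above_tangent[OF pos gap_nonneg] nu_gt_1
        by (intro integral_mono int[of "\<lambda>x. \<phi> k powr \<nu> + \<nu> * \<phi> k powr (\<nu> - 1) * (gap x - \<phi> k)"]
            int[of "\<lambda>x. gap x powr \<nu>"]) auto
      moreover have "expectation (\<lambda>w. \<phi> k powr \<nu> + \<nu> * \<phi> k powr (\<nu> - 1) * (gap (X k w) - \<phi> k))
          = \<phi> k powr \<nu>"
        using int[of gap k] by (simp add: prob_space \<phi>_def[symmetric])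
      ultimately show ?thesis by simp
    qed (simp add: Bochner_Integration.integral_nonneg)
    have "\<phi> (Suc k) = (\<Sum>i\<in>UNIV. L i powr \<alpha> / S_sum L \<alpha> * expectation (\<lambda>w. gap (step i (X k w))))"
      unfolding \<phi>_def using expectation_random_iteration_Suc[OF rbcd(2,4,5)] by (simp add: rbcd(3))
    also have "\<dots> = expectation (\<lambda>w. \<Sum>i\<in>UNIV. L i powr \<alpha> / S_sum L \<alpha> * gap (step i (X k w)))"
      using int[of "\<lambda>x. gap (step _ x)"] by simp
    also have "\<dots> \<le> expectation (\<lambda>w. gap (X k w) - gap (X k w) powr \<nu> / C)"
      using point level
      by (intro integral_mono int[of "\<lambda>x. gap x - gap x powr \<nu> / C"]
          int[of "\<lambda>x. \<Sum>i\<in>UNIV. L i powr \<alpha> / S_sum L \<alpha> * gap (step i x)"]) auto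
    also have "\<dots> = \<phi> k - expectation (\<lambda>w. gap (X k w) powr \<nu>) / C"
      using int[of gap k] int[of "\<lambda>x. gap x powr \<nu>" k] by (simp add: \<phi>_def)
    also have "\<dots> \<le> \<phi> k - \<phi> k powr \<nu> / C"
      using jensen \<open>C > 0\<close> by (intro diff_left_mono divide_right_mono) auto
    finally show ?thesis .
  qed
  have gamma_eq: "1 / (\<nu> - 1) = \<gamma>"
    using gamma nu_minus_1 by simp
  have B: "B > 0" using nu_gt_1 by (simp add: B_def)
  have rate_eq: "C powr (1 / (\<nu> - 1)) * (\<nu> - 1)
      / (2 * \<nu> powr (\<nu> - 1) + (\<nu> - 1) powr \<nu> * real k) powr (1 / (\<nu> - 1))
      = (C / (B + (\<nu> - 1) * real k)) powr (1 / (\<nu> - 1))" for k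
  proof -
    have eq: "(\<nu> - 1) powr \<nu> = (\<nu> - 1) powr (\<nu> - 1) * (\<nu> - 1)"
      using nu_gt_1 by (simp add: powr_diff)
    have "2 * \<nu> powr (\<nu> - 1) + (\<nu> - 1) powr \<nu> * real k
        = (\<nu> - 1) powr (\<nu> - 1) * (B + (\<nu> - 1) * real k)"
      unfolding eq using nu_gt_1 by (simp add: B_def powr_divide distrib_left mult_ac)
    moreover have "((\<nu> - 1) powr (\<nu> - 1)) powr (1 / (\<nu> - 1)) = \<nu> - 1"
      using nu_gt_1 by (simp add: powr_powr)
    ultimately show ?thesis
      using nu_gt_1 B S by (simp add: powr_mult powr_divide C_def)
  qed
  have rate: "\<phi> k \<le> (C / (B + (\<nu> - 1) * real k)) powr (1 / (\<nu> - 1))" for k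
  \<comment> \<open>\<open>R = 0\<close> would make the divisor \<open>C\<close> zero; in that case
    the initial bound already forces the gap to vanish.\<close>
  proof (cases "R = 0")
    case True
    then have "\<phi> k \<le> 0"
      using \<phi>_init \<phi>_le_init[of k] gamma by simp
    then show ?thesis by (rule order_trans) simp
  next
    case False
    then have "R > 0" using \<open>R \<ge> 0\<close> by simp
    show ?thesis
    proof (rule rate_recurrence[where \<phi> = \<phi>, OF nu_gt_1 _ B \<phi>_nonneg \<phi>_step[OF \<open>R > 0\<close>]])
      show "C > 0" using nu_gt_1 S \<open>R > 0\<close> by (simp add: C_def)
      have exps: "\<gamma> * \<nu> = 1 + \<gamma>" "\<gamma> * (\<nu> - 1) = 1"
        using gamma by (simp_all add: nu field_simps)
      \<comment> \<open>The initial value that the rate allows exceeds the proven bound by the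
        factor \<open>(\<nu> / 2) powr \<gamma>\<close>, which is at least \<open>1\<close> because
        \<open>\<gamma> \<le> 1\<close> means \<open>\<nu> \<ge> 2\<close>.\<close>
      have "(C / B) powr (1 / (\<nu> - 1)) = (\<nu> / 2) powr \<gamma> * (S_sum L \<alpha> powr \<gamma> * R powr (1 + \<gamma>) / (1 + \<gamma>))"
        unfolding gamma_eq B_def C_def using nu_gt_1 S \<open>R > 0\<close> gamma
        by (simp add: powr_mult powr_divide powr_powr conjugate exps mult_ac)
      moreover have "(\<nu> / 2) powr \<gamma> \<ge> 1"
        using gamma by (intro ge_one_powr_ge_zero) (auto simp: nu field_simps)
      ultimately show "\<phi> 0 \<le> (C / B) powr (1 / (\<nu> - 1))"
        using \<phi>_init S gamma by (smt (verit) mult_le_cancel_right1 mult_nonneg_nonneg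
            divide_nonneg_pos powr_ge_zero)
    qed
  qed
  have "(\<lambda>k. (C / (B + (\<nu> - 1) * real k)) powr (1 / (\<nu> - 1))) \<in> O(\<lambda>k. real k powr (- 1 / (\<nu> - 1)))"
  proof (rule bigoI)
    show "\<forall>\<^sub>F k in sequentially. norm ((C / (B + (\<nu> - 1) * real k)) powr (1 / (\<nu> - 1)))
        \<le> (C / (\<nu> - 1)) powr (1 / (\<nu> - 1)) * norm (real k powr (- 1 / (\<nu> - 1)))"
      using eventually_gt_at_top[of 0]
    proof eventually_elim
      case (elim k)
      have "C \<ge> 0" using nu_gt_1 S by (simp add: C_def)
      have "(C / (B + (\<nu> - 1) * real k)) powr (1 / (\<nu> - 1)) \<le> (C / ((\<nu> - 1) * real k)) powr (1 / (\<nu> - 1))"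
        using \<open>C \<ge> 0\<close> nu_gt_1 B elim by (intro powr_mono2 divide_left_mono) (auto intro!: mult_pos_pos add_pos_pos)
      also have "\<dots> = (C / (\<nu> - 1)) powr (1 / (\<nu> - 1)) * real k powr (- 1 / (\<nu> - 1))"
        using \<open>C \<ge> 0\<close> nu_gt_1 elim by (simp add: powr_divide powr_mult powr_minus_divide)
      finally show ?case by simp
    qed
  qed
  with rate show ?thesis
    unfolding C_def[symmetric] rate_eq \<phi>_eq by blast
qed

end
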